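(* Let $m\ge 1$ and let $a_0,a_1,\dots,a_m\in\mathbb C$. Put $a_{-j}=a_j$ for $1\le j\le m$ and $a_s=0$ for $|s|>m$, and let $D_n=\det(a_{j-i})_{i,j=1}^n$. Then the sequence $(D_n)_{n\ge 0}$ has a homogeneous constant-coefficient annihilating recurrence of degree at most $$\frac{3^m+1}{2}.$$
   Context: $D_0=1$. A homogeneous constant-coefficient annihilating recurrence of degree $d$ for $(u_n)_{n\ge0}$ is a relation $u_{n+d}+c_1u_{n+d-1}+\dots+c_du_n=0$ valid for all $n\ge0$, with constants $c_1,\dots,c_d$ independent of $n$. *)

theory Defs
  imports Complex_Main "Jordan_Normal_Form.Determinant"
begin

definition sym_band_ext :: "nat \<Rightarrow> (nat \<Rightarrow> complex) \<Rightarrow> int \<Rightarrow> complex" where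
  "sym_band_ext m a s = (if \<bar>s\<bar> \<le> int m then a (nat \<bar>s\<bar>) else 0)"

(* Rows and columns are numbered from 0; the entry depends only on j - i. *)
definition toeplitz_mat :: "(int \<Rightarrow> complex) \<Rightarrow> nat \<Rightarrow> complex mat" where
  "toeplitz_mat b n = mat n n (\<lambda>(i, j). b (int j - int i))"

(* For n = 0 the library determinant of the empty matrix is 1. *)
definition toeplitz_det :: "(int \<Rightarrow> complex) \<Rightarrow> nat \<Rightarrow> complex" where
  "toeplitz_det b n = det (toeplitz_mat b n)"

lemma toeplitz_det_0: "toeplitz_det b 0 = 1"
  by (simp add: toeplitz_det_def toeplitz_mat_def)

(* The trailing coefficients c d, c (d - 1), ... may vanish; only the leading one is fixed to 1. *)
definition annihilating_recurrence :: "(nat \<Rightarrow> complex) \<Rightarrow> nat \<Rightarrow> (nat \<Rightarrow> complex) \<Rightarrow> bool" where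
  "annihilating_recurrence u d c \<longleftrightarrow> (\<forall>n. u (n + d) + (\<Sum>k = 1..d. c k * u (n + d - k)) = 0)"

end

theory Submission
  imports Defs "HOL-Computational_Algebra.Fundamental_Theorem_Algebra"
begin

text \<open>After lowering \<open>m\<close> we may assume \<open>a m \<noteq> 0\<close>. The symbol then factors as
  \<open>a m (X - x\<^sub>1) (X - 1/x\<^sub>1) \<cdots> (X - x\<^sub>m) (X - 1/x\<^sub>m)\<close>. For distinct roots, Widom's formula writes
  \<open>D\<^sub>n\<close> as a linear combination of \<open>n\<close>-th powers of \<open>(-1)\<^sup>m a m \<Prod>S\<close>, where \<open>S\<close> runs over the
  \<open>m\<close>-element sets of roots. Because the roots come in reciprocal pairs, these products have the form
  \<open>\<Prod> x\<^sub>i\<^bsup>e\<^sub>i\<^esup>\<close> with \<open>e \<in> {-1, 0, 1}\<^sup>m\<close>, and \<open>|S| = m\<close> forces \<open>\<Sum> e\<^sub>i \<equiv> m (mod 2)\<close>; there are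
  \<open>(3\<^sup>m + 1) / 2\<close> such vectors. Coinciding roots follow by continuity.\<close>

section \<open>Vandermonde matrices and banded Toeplitz determinants\<close>

text \<open>A kernel vector of the transposed matrix is the coefficient vector of a polynomial of
  degree below \<open>K\<close> with the \<open>K\<close> distinct roots \<open>z k\<close>, so it
  vanishes.\<close>

lemma vandermonde_det_nonzero:
  fixes z :: "nat \<Rightarrow> complex"
  assumes "inj_on z {..<K}"
  shows "det (mat K K (\<lambda>(i, k). z k ^ i)) \<noteq> 0"
proof
  let ?V = "mat K K (\<lambda>(k, i). z k ^ i)"
  assume "det (mat K K (\<lambda>(i, k). z k ^ i)) = 0"
  also have "mat K K (\<lambda>(i, k). z k ^ i) = transpose_mat ?V" by (rule eq_matI) auto
  also have "det (transpose_mat ?V) = det ?V" by (rule det_transpose[of _ K]) auto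
  finally obtain v where v: "v \<in> carrier_vec K" "v \<noteq> 0\<^sub>v K" "?V *\<^sub>v v = 0\<^sub>v K"
    using det_0_iff_vec_prod_zero_field[of ?V K] by auto
  define p where "p = (\<Sum>i<K. monom (v $ i) i)"
  have coeff_p: "coeff p i = (if i < K then v $ i else 0)" for i
    by (simp add: p_def coeff_sum if_distrib cong: if_cong)
  have "poly p (z k) = 0" if "k < K" for k
  proof -
    have "0 = (?V *\<^sub>v v) $ k" using that v(3) by simp
    also have "\<dots> = (\<Sum>i<K. v $ i * z k ^ i)"
      using that v(1) by (simp add: scalar_prod_def atLeast0LessThan mult.commute)
    finally show ?thesis by (simp add: p_def poly_sum poly_monom)
  qed
  then have sub: "z ` {..<K} \<subseteq> {x. poly p x = 0}" by auto
  have "p = 0"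
  proof (rule ccontr)
    assume "p \<noteq> 0"
    have "K = card (z ` {..<K})" using assms by (simp add: card_image)
    also have "\<dots> \<le> card {x. poly p x = 0}"
      using sub poly_roots_finite[OF \<open>p \<noteq> 0\<close>] card_mono by blast
    also have "\<dots> \<le> degree p" using \<open>p \<noteq> 0\<close> by (rule card_poly_roots_bound)
    also have "degree p < K"
      using \<open>p \<noteq> 0\<close> coeff_p[of "degree p"] leading_coeff_neq_0 by (metis)
    finally show False by simp
  qed
  then have "v $ i = 0" if "i < K" for i using coeff_p[of i] that by simp
  then have "v = 0\<^sub>v K" using v(1) by (intro eq_vecI) auto
  with v(2) show False by simp
qed

text \<open>The coefficient of index \<open>r\<close> sits on the diagonal. The guard blocks
  truncated subtraction below the band; above it \<open>coeff\<close> is 0 by itself.\<close>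

definition band_toeplitz :: "nat \<Rightarrow> complex poly \<Rightarrow> nat \<Rightarrow> complex mat" where
  "band_toeplitz r p n = mat n n (\<lambda>(i, j). if i \<le> r + j then coeff p (r + j - i) else 0)"

text \<open>The banded \<open>n \<times> (n + K)\<close> matrix of all shifts of \<open>p\<close> annihilates the vectors
  \<open>(1, z k, z k\<^sup>2, \<dots>)\<close>. Bordering it by \<open>r\<close> first and \<open>s\<close> last unit rows gives a square matrix
  \<open>M\<close> with determinant \<open>\<plusminus> det (band_toeplitz r p n)\<close>; multiplying it by the Vandermonde block
  completed by unit columns produces a block triangular matrix.\<close>

lemma band_toeplitz_det_vandermonde:
  fixes z :: "nat \<Rightarrow> complex"
  assumes roots: "\<And>k. k < r + s \<Longrightarrow> poly p (z k) = 0" and deg: "degree p \<le> r + s"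
  shows "det (band_toeplitz r p n) * det (mat (r + s) (r + s) (\<lambda>(i, k). z k ^ i)) =
    ((-1) ^ s * coeff p (r + s)) ^ n *
      det (mat (r + s) (r + s) (\<lambda>(i, k). z k ^ (if i < r then i else i + n)))"
proof -
  define K where "K = r + s"
  let ?V = "mat K K (\<lambda>(i, k). z k ^ i)"
  let ?Q = "mat K K (\<lambda>(i, k). z k ^ (if i < r then i else i + n))"
  let ?T = "band_toeplitz r p n"
  define B where "B i j = (if i \<le> j then coeff p (j - i) else 0)" for i j :: nat
  define f where "f = (\<lambda>(i, j). if i < r then (if j = i then 1 else 0)
     else if i < K then (if j = i + n then 1 else 0) else B (i - K) j)"
  define M where "M = mat (K + n) (K + n) f"
  define A2 where "A2 = mat (s + n) (s + n) (\<lambda>(i, j). f (i + r, j + r))"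
  have M1: "M = four_block_mat (1\<^sub>m r) (0\<^sub>m r (s + n)) (mat (s + n) r (\<lambda>(i, j). f (i + r, j))) A2"
    by (rule eq_matI) (auto simp: M_def A2_def f_def K_def)
  have "det M = det (1\<^sub>m r) * det A2"
    unfolding M1 by (rule det_four_block_mat_upper_right_zero) (auto simp: A2_def)
  then have det_M_A2: "det M = det A2" by simp
  \<comment> \<open>Moving the \<open>s\<close> unit rows below the \<open>n\<close> band rows costs
    the sign \<open>(-1) ^ (n * s)\<close>. With the first \<open>r\<close> columns gone, the band
    rows begin with \<open>?T\<close>.\<close>
  define A3 where "A3 = four_block_mat ?T (mat n s (\<lambda>(i, j). B i (j + n + r))) (0\<^sub>m s n) (1\<^sub>m s)"
  have A2: "A2 \<in> carrier_mat (n + s) (n + s)" by (simp add: A2_def add.commute)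
  have "mat (n + s) (n + s) (\<lambda>(i, j). A2 $$ (if i < n then i + s else i - n, j)) = A3"
    by (rule eq_matI) (auto simp: A2_def A3_def f_def K_def band_toeplitz_def B_def ac_simps)
  with det_swap_rows[OF A2] have det_A2: "det A2 = (-1) ^ (n * s) * det A3" by metis
  have "det A3 = det ?T"
    unfolding A3_def
    by (subst det_four_block_mat_lower_left_zero[of _ n _ s]) (auto simp: band_toeplitz_def)
  with det_M_A2 det_A2 have det_M: "det M = (-1) ^ (n * s) * det ?T" by simp
  define W where "W = four_block_mat ?V (0\<^sub>m K n) (mat n K (\<lambda>(i, k). z k ^ (K + i))) (1\<^sub>m n)"
  have W: "W \<in> carrier_mat (K + n) (K + n)" by (simp add: W_def)
  have W1: "W $$ (j, k) = z k ^ j" if "j < K + n" "k < K" for j k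
    using that by (auto simp: W_def)
  have W2: "W $$ (j, k) = (if j = k then 1 else 0)" if "j < K + n" "K \<le> k" "k < K + n" for j k
    using that by (auto simp: W_def)
  have det_W: "det W = det ?V"
    unfolding W_def by (subst det_four_block_mat_upper_right_zero[of _ K _ n]) auto
  define L where "L = mat n n (\<lambda>(i, k). B i (K + k))"
  define C where "C = mat K n (\<lambda>(i, k). f (i, K + k))"
  have M: "M \<in> carrier_mat (K + n) (K + n)" by (simp add: M_def)
  have MW: "(M * W) $$ (i, k) = (\<Sum>j<K+n. f (i, j) * W $$ (j, k))" if "i < K + n" "k < K + n" for i k
    using that M W by (simp add: scalar_prod_def M_def atLeast0LessThan)
  \<comment> \<open>Unit rows select the exponents \<open>i < r\<close> and \<open>i + n\<close>,
    which gives \<open>?Q\<close>; band row \<open>i'\<close> meets power column \<open>k\<close> in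
    \<open>z k ^ i' * poly p (z k) = 0\<close>.\<close>
  have "M * W = four_block_mat ?Q C (0\<^sub>m n K) L"
  proof (rule eq_matI)
    fix i k assume "i < dim_row (four_block_mat ?Q C (0\<^sub>m n K) L)"
      "k < dim_col (four_block_mat ?Q C (0\<^sub>m n K) L)"
    then have i: "i < K + n" and k: "k < K + n" by (auto simp: L_def)
    show "(M * W) $$ (i, k) = four_block_mat ?Q C (0\<^sub>m n K) L $$ (i, k)"
    proof (cases "K \<le> k")
      case True
      have "(M * W) $$ (i, k) = (\<Sum>j<K+n. if j = k then f (i, j) else 0)"
        unfolding MW[OF i k] using True k by (intro sum.cong) (auto simp: W2)
      then show ?thesis using i k True by (auto simp: C_def L_def f_def K_def)
    next
      case False
      have e: "(M * W) $$ (i, k) = (\<Sum>j<K+n. f (i, j) * z k ^ j)"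
        unfolding MW[OF i k] using False by (intro sum.cong) (auto simp: W1)
      consider "i < r" | "r \<le> i" "i < K" | "K \<le> i" by linarith
      then show ?thesis
      proof cases
        case 1
        have "(M * W) $$ (i, k) = (\<Sum>j<K+n. if j = i then z k ^ j else 0)"
          unfolding e using 1 by (intro sum.cong) (auto simp: f_def)
        then show ?thesis using 1 False i k by (auto simp: K_def)
      next
        case 2
        have "(M * W) $$ (i, k) = (\<Sum>j<K+n. if j = i + n then z k ^ j else 0)"
          unfolding e using 2 by (intro sum.cong) (auto simp: f_def)
        then show ?thesis using 2 False i k by auto
      next
        case 3
        define i' where "i' = i - K"
        have i': "i' < n" "i = K + i'" using 3 i by (auto simp: i'_def)
        have "(M * W) $$ (i, k) = (\<Sum>j<K+n. if i' \<le> j then coeff p (j - i') * z k ^ j else 0)"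
          unfolding e using 3 by (intro sum.cong) (auto simp: f_def B_def i'_def K_def)
        also have "\<dots> = (\<Sum>j\<in>{i'..i'+K}. coeff p (j - i') * z k ^ j)"
          using i' deg by (intro sum.mono_neutral_cong_right)
            (auto intro!: coeff_eq_0 simp: K_def)
        also have "\<dots> = (\<Sum>j\<le>K. coeff p j * z k ^ (j + i'))"
          using sum.shift_bounds_cl_nat_ivl[of "\<lambda>j. coeff p (j - i') * z k ^ j" 0 i' K]
          by (simp add: atMost_atLeast0 add.commute)
        also have "\<dots> = z k ^ i' * poly p (z k)"
        proof -
          have "poly p (z k) = (\<Sum>j\<le>K. coeff p j * z k ^ j)"
            unfolding poly_altdef using deg
            by (intro sum.mono_neutral_left) (auto simp: K_def intro!: coeff_eq_0)
          then show ?thesis by (simp add: power_add sum_distrib_left mult_ac)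
        qed
        also have "\<dots> = 0" using roots[of k] False by (simp add: K_def)
        finally show ?thesis using 3 i False by (auto simp: L_def)
      qed
    qed
  qed (use M W in \<open>auto simp: L_def\<close>)
  then have "det (M * W) = det ?Q * det L"
    by (simp add: det_four_block_mat_lower_left_zero[of _ K _ n] C_def L_def)
  \<comment> \<open>Above its diagonal \<open>L\<close> holds coefficients of index greater than
    \<open>K\<close>, which vanish by \<open>deg\<close>; on the diagonal it holds
    \<open>coeff p K\<close>.\<close>
  also have "det L = prod_list (diag_mat L)"
    using deg by (intro det_lower_triangular[of n])
      (auto simp: L_def B_def K_def intro!: coeff_eq_0)
  also have "diag_mat L = replicate n (coeff p K)"
    by (rule nth_equalityI) (auto simp: diag_mat_def L_def B_def)
  finally have "det M * det W = det ?Q * coeff p K ^ n"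
    by (simp add: det_mult[OF M W])
  then have *: "e * det ?T * det ?V = det ?Q * coeff p K ^ n" if "e = (-1) ^ (n * s)" for e
    unfolding det_M det_W that .
  define e :: complex where "e = (-1) ^ (n * s)"
  have "e * e = 1" by (simp add: e_def flip: power_mult_distrib)
  then have "det ?T * det ?V = e * (e * det ?T * det ?V)" by (simp flip: mult.assoc)
  also have "\<dots> = e * coeff p K ^ n * det ?Q"
    unfolding *[OF e_def] by simp
  also have "e * coeff p K ^ n = ((-1) ^ s * coeff p K) ^ n"
    unfolding e_def by (simp add: power_mult_distrib mult.commute[of n s] power_mult)
  finally show ?thesis by (simp add: K_def)
qed

section \<open>Sign vectors and products of half of the roots\<close>

definition sign_vectors :: "nat \<Rightarrow> int list set" where
  "sign_vectors m = {e. length e = m \<and> set e \<subseteq> {-1, 0, 1} \<and> even (sum_list e + int m)}"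

text \<open>Both parity classes are counted together: prepending 0 switches the class, since only
  the length changes parity, while prepending 1 or -1 keeps it. The counts are
  \<open>(3 ^ m + 1) / 2\<close> and \<open>(3 ^ m - 1) / 2\<close>.\<close>

lemma card_sign_vectors: "finite (sign_vectors m)" "2 * card (sign_vectors m) = 3 ^ m + 1"
proof -
  define S where "S m b = {e :: int list. length e = m \<and> set e \<subseteq> {-1, 0, 1} \<and>
    even (sum_list e + int m) = b}" for m b
  have Suc': "S (Suc m) b = (#) 0 ` S m (\<not> b) \<union> ((#) 1 ` S m b \<union> (#) (-1) ` S m b)"
    (is "_ = ?R") for m b
  proof (rule Set.set_eqI)
    fix e
    show "e \<in> S (Suc m) b \<longleftrightarrow> e \<in> ?R"
      by (cases e) (auto simp: S_def image_iff)
  qed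
  have fin: "finite (S m b)" for m b
    by (induction m arbitrary: b) (auto simp: Suc', simp add: S_def)
  have "2 * card (S m True) = 3 ^ m + 1 \<and> 2 * card (S m False) + 1 = 3 ^ m"
  proof (induction m)
    case 0
    have "S 0 True = {[]}" "S 0 False = {}" by (auto simp: S_def)
    then show ?case by simp
  next
    case (Suc m)
    have "card (S (Suc m) b) = card (S m (\<not> b)) + 2 * card (S m b)" for b
      unfolding Suc'
      by (subst card_Un_disjoint; (subst card_Un_disjoint)?)
        (auto simp: card_image fin)
    with Suc.IH show ?case by simp
  qed
  then show "2 * card (sign_vectors m) = 3 ^ m + 1"  "finite (sign_vectors m)"
    using fin[of m True] by (simp_all add: S_def sign_vectors_def)
qed

lemma prod_lessThan_add:
  fixes f :: "nat \<Rightarrow> 'a :: comm_monoid_mult"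
  shows "(\<Prod>k<m+n. f k) = (\<Prod>k<m. f k) * (\<Prod>k<n. f (m + k))"
  by (induction n) (simp_all add: mult_ac)

lemma sum_lessThan_add:
  fixes f :: "nat \<Rightarrow> 'a :: comm_monoid_add"
  shows "(\<Sum>k<m+n. f k) = (\<Sum>k<m. f k) + (\<Sum>k<n. f (m + k))"
  by (induction n) (simp_all add: add_ac)

definition paired_roots :: "nat \<Rightarrow> (nat \<Rightarrow> complex) \<Rightarrow> nat \<Rightarrow> complex" where
  "paired_roots m x k = (if k < m then x k else inverse (x (k - m)))"

text \<open>The exponent of \<open>x i\<close> is \<open>[i \<in> S] - [m + i \<in> S]\<close>.
  Adding \<open>m = card S\<close> to the sum of the exponents gives twice the number of
  \<open>i < m\<close> in \<open>S\<close>, hence the parity.\<close>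

lemma prod_paired_roots:
  assumes nz: "\<And>i. i < m \<Longrightarrow> x i \<noteq> 0" and S: "S \<subseteq> {..<m+m}" "card S = m"
  shows "\<exists>e\<in>sign_vectors m. (\<Prod>k\<in>S. paired_roots m x k) = (\<Prod>i<m. x i powi (e ! i))"
proof -
  define c :: "nat \<Rightarrow> int" where "c k = of_bool (k \<in> S)" for k
  define e where "e = map (\<lambda>i. c i - c (m + i)) [0..<m]"
  have "int m = (\<Sum>k<m+m. c k)"
    using S by (simp add: c_def of_bool_def Int_absorb1 flip: sum.inter_restrict[of "{..<m+m}"])
  also have "\<dots> = (\<Sum>k<m. c k) + (\<Sum>k<m. c (m + k))"
    by (rule sum_lessThan_add)
  finally have m: "int m = (\<Sum>k<m. c k) + (\<Sum>k<m. c (m + k))" .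
  have "sum_list e = (\<Sum>k<m. c k) - (\<Sum>k<m. c (m + k))"
    by (simp add: e_def interv_sum_list_conv_sum_set_nat atLeast0LessThan sum_subtractf)
  with m have "even (sum_list e + int m)" by simp
  moreover have "set e \<subseteq> {-1, 0, 1}" by (auto simp: e_def c_def of_bool_def split: if_splits)
  ultimately have "e \<in> sign_vectors m" by (simp add: sign_vectors_def e_def)
  moreover have "(\<Prod>k\<in>S. paired_roots m x k) = (\<Prod>k<m+m. if k \<in> S then paired_roots m x k else 1)"
    using S(1) by (simp add: Int_absorb1 flip: prod.inter_restrict)
  then have "(\<Prod>k\<in>S. paired_roots m x k) = (\<Prod>i<m. x i powi (e ! i))"
    unfolding prod_lessThan_add
    by (simp flip: prod.distrib)
       (auto intro!: prod.cong simp: paired_roots_def e_def c_def nz power_int_minus)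
  ultimately show ?thesis by blast
qed

section \<open>Reciprocal factorization of the symbol\<close>

text \<open>This is \<open>2 T_n (X / 2)\<close> for the Chebyshev polynomial \<open>T_n\<close> of
  the first kind; it expresses \<open>x ^ n + 1 / x ^ n\<close> through
  \<open>x + 1 / x\<close>.\<close>

fun dickson :: "nat \<Rightarrow> complex poly" where
  "dickson 0 = [:2:]"
| "dickson (Suc 0) = [:0, 1:]"
| "dickson (Suc (Suc n)) = [:0, 1:] * dickson (Suc n) - dickson n"

lemma poly_dickson:
  assumes "x \<noteq> 0"
  shows "poly (dickson n) (x + inverse x) = x ^ n + inverse x ^ n"
proof -
  have *: "x * (inverse x * y) = y" for y using assms by (simp flip: mult.assoc)
  show ?thesis
    by (induction n rule: dickson.induct) (simp_all add: algebra_simps *)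
qed

lemma coeff_dickson_above: "i > n \<Longrightarrow> coeff (dickson n) i = 0"
  by (induction n arbitrary: i rule: dickson.induct) (auto simp: coeff_pCons split: nat.splits)

lemma coeff_dickson_lead: "n > 0 \<Longrightarrow> coeff (dickson n) n = 1"
  by (induction n rule: dickson.induct) (auto simp: coeff_dickson_above)

text \<open>The Laurent symbol, the sum of \<open>a_s X ^ s\<close> over \<open>|s| \<le> m\<close>,
  is multiplied by \<open>X ^ m\<close> to make it a polynomial.\<close>

definition sym_poly :: "nat \<Rightarrow> (nat \<Rightarrow> complex) \<Rightarrow> complex poly" where
  "sym_poly m a = (\<Sum>k\<le>m+m. monom (sym_band_ext m a (int k - int m)) k)"

lemma coeff_sym_poly:
  "coeff (sym_poly m a) k = (if k \<le> m + m then sym_band_ext m a (int k - int m) else 0)"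
  by (simp add: sym_poly_def coeff_sum if_distrib cong: if_cong)

lemma poly_sym_poly:
  assumes "x \<noteq> 0"
  shows "poly (sym_poly m a) x = x ^ m * (a 0 + (\<Sum>j=1..m. a j * (x ^ j + inverse x ^ j)))"
proof -
  let ?b = "\<lambda>k. sym_band_ext m a (int k - int m) * x ^ k"
  have "poly (sym_poly m a) x = (\<Sum>k\<le>m+m. ?b k)" by (simp add: sym_poly_def poly_sum poly_monom)
  also have "{..m+m} = {..<m} \<union> ({m} \<union> {Suc m..m+m})" by auto
  also have "sum ?b \<dots> = sum ?b {..<m} + (?b m + sum ?b {Suc m..m+m})"
    by (subst sum.union_disjoint; auto)+
  also have "?b m = x ^ m * a 0" by (simp add: sym_band_ext_def)
  also have "sum ?b {..<m} = (\<Sum>j=1..m. ?b (m - j))"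
    by (rule sum.reindex_bij_witness[of _ "\<lambda>j. m - j" "\<lambda>j. m - j"]) auto
  also have "\<dots> = (\<Sum>j=1..m. x ^ m * (a j * inverse x ^ j))"
    using assms by (intro sum.cong) (auto simp: sym_band_ext_def of_nat_diff power_diff field_simps)
  also have "sum ?b {Suc m..m+m} = (\<Sum>j=1..m. ?b (m + j))"
    by (rule sum.reindex_bij_witness[of _ "\<lambda>j. m + j" "\<lambda>j. j - m"]) auto
  also have "\<dots> = (\<Sum>j=1..m. x ^ m * (a j * x ^ j))"
    by (intro sum.cong) (auto simp: sym_band_ext_def power_add)
  finally show ?thesis
    by (simp add: sum_distrib_left sum.distrib algebra_simps)
qed

text \<open>A root of \<open>X ^ 2 - y X + 1\<close> works; the constant term 1 rules out 0.\<close>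

lemma exists_reciprocal_pair:
  fixes y :: complex
  shows "\<exists>x. x \<noteq> 0 \<and> x + inverse x = y"
proof -
  have "\<not> constant (poly [:1, -y, 1:])" by (simp add: constant_degree)
  then obtain x where x: "1 + x * (x - y) = 0"
    using fundamental_theorem_of_algebra[of "[:1, -y, 1:]"] by (auto simp: algebra_simps)
  then have "x \<noteq> 0" by auto
  moreover from this x have "x + inverse x = y" by (simp add: field_simps)
  ultimately show ?thesis by blast
qed

definition paired_poly :: "nat \<Rightarrow> (nat \<Rightarrow> complex) \<Rightarrow> complex poly" where
  "paired_poly m x = (\<Prod>k<m+m. [:- paired_roots m x k, 1:])"

text \<open>Dickson polynomials turn the symbol into \<open>q (X + 1 / X)\<close> with
  \<open>q\<close> of degree \<open>m\<close>. Each root \<open>y\<close> of \<open>q\<close> is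
  written as \<open>x + 1 / x\<close>, and \<open>u (u + 1 / u - y) = (u - x) (u - 1 / x)\<close>
  splits its factor.\<close>

lemma sym_poly_factorization:
  assumes "a m \<noteq> 0"
  shows "\<exists>x. (\<forall>i. x i \<noteq> 0) \<and> sym_poly m a = smult (a m) (paired_poly m x)"
proof -
  define q where "q = [:a 0:] + (\<Sum>j=1..m. smult (a j) (dickson j))"
  have q: "poly (sym_poly m a) x = x ^ m * poly q (x + inverse x)" if "x \<noteq> 0" for x
    using that by (simp add: poly_sym_poly q_def poly_sum poly_dickson)
  have above: "coeff q i = 0" if "i > m" for i
    using that by (auto simp: q_def coeff_sum coeff_dickson_above coeff_pCons split: nat.splits
      intro!: sum.neutral)
  have lead: "coeff q m = a m"
  proof (cases m)
    case (Suc k)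
    have "(\<Sum>j=1..m. a j * coeff (dickson j) m) = (\<Sum>j=1..m. if j = m then a j else 0)"
      by (intro sum.cong) (auto simp: coeff_dickson_above coeff_dickson_lead)
    then show ?thesis using Suc by (simp add: q_def coeff_sum)
  qed (simp add: q_def)
  have deg: "degree q = m"
    using above lead assms by (intro antisym degree_le le_degree) auto
  then have "q \<noteq> 0" using assms lead by auto
  then obtain A where A: "size A = m" "q = smult (a m) (\<Prod>y\<in>#A. [:-y, 1:])"
    using alg_closed_imp_factorization[of q] deg lead by auto
  obtain ys where ys: "mset ys = A" using ex_mset by blast
  with A have "length ys = m" by auto
  have "\<forall>i. \<exists>x. x \<noteq> 0 \<and> x + inverse x = ys ! i" using exists_reciprocal_pair by blast
  then obtain x where x: "\<And>i. x i \<noteq> 0" "\<And>i. x i + inverse (x i) = ys ! i" by metis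
  have q_fact: "q = smult (a m) (\<Prod>i<m. [:- (ys ! i), 1:])"
    using A(2) \<open>length ys = m\<close>
    by (simp add: prod_mset_prod_list prod.list_conv_set_nth atLeast0LessThan flip: ys mset_map)
  have "poly (sym_poly m a) u = poly (smult (a m) (paired_poly m x)) u" if "u \<noteq> 0" for u
  proof -
    have "poly (sym_poly m a) u = a m * (u ^ m * (\<Prod>i<m. u + inverse u - ys ! i))"
      by (simp add: q[OF that] q_fact poly_prod algebra_simps)
    also have "u ^ m * (\<Prod>i<m. u + inverse u - ys ! i) = (\<Prod>i<m. u * (u + inverse u - ys ! i))"
      by (simp add: prod.distrib)
    also have "\<dots> = (\<Prod>i<m. (u - x i) * (u - inverse (x i)))"
      using that x(1) by (intro prod.cong) (simp_all add: field_simps flip: x(2))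
    also have "\<dots> = poly (paired_poly m x) u"
      by (simp add: poly_prod paired_poly_def prod_lessThan_add paired_roots_def prod.distrib)
    finally show ?thesis by simp
  qed
  \<comment> \<open>The identity is known only for \<open>u \<noteq> 0\<close>; the factor
    \<open>X\<close> makes it hold at 0 too and is cancelled afterwards.\<close>
  then have "poly ([:0, 1:] * sym_poly m a) u = poly ([:0, 1:] * smult (a m) (paired_poly m x)) u" for u
    by (cases "u = 0") auto
  then have "[:0, 1:] * sym_poly m a = [:0, 1:] * smult (a m) (paired_poly m x)"
    by (simp only: fun_eq_iff flip: poly_eq_poly_eq_iff) blast
  then show ?thesis using x(1) by auto
qed

section \<open>The recurrence for distinct roots\<close>

lemma toeplitz_mat_sym_band_ext:
  "toeplitz_mat (sym_band_ext m a) n = band_toeplitz m (sym_poly m a) n"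
  by (rule eq_matI)
    (auto simp: toeplitz_mat_def band_toeplitz_def coeff_sym_poly sym_band_ext_def of_nat_diff)

lemma degree_paired_poly: "degree (paired_poly m x) = m + m"
  unfolding paired_poly_def by (subst degree_prod_eq_sum_degree) auto

lemma coeff_paired_poly_lead: "coeff (paired_poly m x) (m + m) = 1"
proof -
  have "lead_coeff (paired_poly m x) = 1" unfolding paired_poly_def lead_coeff_prod by simp
  then show ?thesis by (simp add: degree_paired_poly)
qed

text \<open>One factor is kept per sign vector even when values coincide, so the degree does not
  depend on \<open>x\<close> and the coefficients are continuous in nonzero
  \<open>x i\<close>.\<close>

definition widom_poly :: "nat \<Rightarrow> complex \<Rightarrow> (nat \<Rightarrow> complex) \<Rightarrow> complex poly" where
  "widom_poly m c x = (\<Prod>e\<in>sign_vectors m. [:- ((-1) ^ m * c * (\<Prod>i<m. x i powi (e ! i))), 1:])"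

lemma degree_widom_poly: "degree (widom_poly m c x) = card (sign_vectors m)"
  unfolding widom_poly_def by (subst degree_prod_eq_sum_degree) auto

lemma coeff_widom_poly_lead: "coeff (widom_poly m c x) (card (sign_vectors m)) = 1"
proof -
  have "lead_coeff (widom_poly m c x) = 1" unfolding widom_poly_def lead_coeff_prod by simp
  then show ?thesis by (simp add: degree_widom_poly)
qed

lemma permutes_less:
  fixes \<sigma> :: "nat \<Rightarrow> nat"
  shows "\<sigma> permutes {0..<n} \<Longrightarrow> i < n \<Longrightarrow> \<sigma> i < n"
  using permutes_in_image[of \<sigma> "{0..<n}" i] by simp

text \<open>Leibniz expansion of the shifted Vandermonde determinant yields \<open>n\<close>-th
  powers of roots of \<open>widom_poly\<close>; distinctness allows division by the unshifted
  one.\<close>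

lemma widom_poly_annihilates_distinct:
  assumes nz: "\<And>i. i < m \<Longrightarrow> x i \<noteq> 0" and inj: "inj_on (paired_roots m x) {..<m+m}"
  shows "(\<Sum>k\<le>card (sign_vectors m). coeff (widom_poly m c x) k *
    det (band_toeplitz m (smult c (paired_poly m x)) (n + k))) = 0"
proof -
  define z where "z = paired_roots m x"
  let ?P = "{\<sigma>. \<sigma> permutes {0..<m+m}}"
  let ?V = "det (mat (m + m) (m + m) (\<lambda>(i, k). z k ^ i))"
  let ?T = "\<lambda>n. det (band_toeplitz m (smult c (paired_poly m x)) n)"
  \<comment> \<open>In row \<open>i \<ge> m\<close> the exponent is \<open>i + n\<close>:
    \<open>g \<sigma>\<close> collects the part free of \<open>n\<close>, and
    \<open>w \<sigma>\<close> is the base of the \<open>n\<close>-th power.\<close>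
  define g where "g \<sigma> = signof \<sigma> * (\<Prod>i=0..<m+m. z (\<sigma> i) ^ i)" for \<sigma>
  define w where "w \<sigma> = (-1) ^ m * c * (\<Prod>i=m..<m+m. z (\<sigma> i))" for \<sigma>
  have expand: "?T n * ?V = (\<Sum>\<sigma>\<in>?P. g \<sigma> * w \<sigma> ^ n)" for n
  proof -
    have "?T n * ?V = ((-1) ^ m * c) ^ n *
        det (mat (m + m) (m + m) (\<lambda>(i, k). z k ^ (if i < m then i else i + n)))"
    proof (subst band_toeplitz_det_vandermonde)
      fix k assume "k < m + m"
      then show "poly (smult c (paired_poly m x)) (z k) = 0"
        by (auto simp: paired_poly_def poly_prod z_def)
    qed (simp_all add: degree_paired_poly coeff_paired_poly_lead order.trans[OF degree_smult_le])
    also have "det (mat (m + m) (m + m) (\<lambda>(i, k). z k ^ (if i < m then i else i + n))) =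
      (\<Sum>\<sigma>\<in>?P. signof \<sigma> * (\<Prod>i=0..<m+m. z (\<sigma> i) ^ (if i < m then i else i + n)))"
      by (subst det_def'[of _ "m + m"]) (auto intro!: sum.cong prod.cong simp: permutes_less)
    also have "\<dots> = (\<Sum>\<sigma>\<in>?P. g \<sigma> * (\<Prod>i=m..<m+m. z (\<sigma> i)) ^ n)"
    proof (intro sum.cong refl)
      fix \<sigma>
      have "(\<Prod>i=0..<m+m. z (\<sigma> i) ^ (if i < m then i else i + n)) =
        (\<Prod>i=0..<m+m. z (\<sigma> i) ^ i * (if i \<in> {m..<m+m} then z (\<sigma> i) ^ n else 1))"
        by (intro prod.cong) (auto simp: power_add)
      also have "\<dots> = (\<Prod>i=0..<m+m. z (\<sigma> i) ^ i) * (\<Prod>i=m..<m+m. z (\<sigma> i) ^ n)"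
        unfolding prod.distrib by (subst prod.inter_restrict[symmetric]) (auto intro: prod.cong)
      finally show "signof \<sigma> * (\<Prod>i=0..<m+m. z (\<sigma> i) ^ (if i < m then i else i + n)) =
          g \<sigma> * (\<Prod>i=m..<m+m. z (\<sigma> i)) ^ n"
        by (simp add: g_def prod_power_distrib mult.assoc)
    qed
    finally show ?thesis
      by (simp add: w_def power_mult_distrib sum_distrib_left mult_ac)
  qed
  \<comment> \<open>The product in \<open>w \<sigma>\<close> runs over the image of
    \<open>{m..<m+m}\<close> under \<open>\<sigma>\<close>, a set of \<open>m\<close> indices, so it
    comes from a sign vector.\<close>
  have root: "poly (widom_poly m c x) (w \<sigma>) = 0" if "\<sigma> \<in> ?P" for \<sigma>
  proof -
    from that have \<sigma>: "\<sigma> permutes {0..<m+m}" by simp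
    then have inj\<sigma>: "inj \<sigma>" by (rule permutes_inj)
    have "\<sigma> ` {m..<m+m} \<subseteq> {..<m+m}"
      using permutes_image[OF \<sigma>] by auto
    moreover have "card (\<sigma> ` {m..<m+m}) = m"
      using inj\<sigma> by (simp add: card_image inj_on_subset)
    ultimately obtain e where "e \<in> sign_vectors m"
      "(\<Prod>k\<in>\<sigma> ` {m..<m+m}. z k) = (\<Prod>i<m. x i powi (e ! i))"
      using prod_paired_roots[where x = x and m = m, OF nz] unfolding z_def by blast
    moreover have "(\<Prod>k\<in>\<sigma> ` {m..<m+m}. z k) = (\<Prod>i=m..<m+m. z (\<sigma> i))"
      using inj\<sigma> by (simp add: prod.reindex inj_on_subset)
    ultimately show ?thesis
      using card_sign_vectors(1)[of m] by (auto simp: widom_poly_def poly_prod w_def)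
  qed
  let ?d = "card (sign_vectors m)"
  let ?C = "coeff (widom_poly m c x)"
  have "(\<Sum>k\<le>?d. ?C k * ?T (n + k)) * ?V = (\<Sum>k\<le>?d. ?C k * (\<Sum>\<sigma>\<in>?P. g \<sigma> * w \<sigma> ^ (n + k)))"
    unfolding expand[symmetric] by (simp add: sum_distrib_right mult.assoc)
  also have "\<dots> = (\<Sum>\<sigma>\<in>?P. \<Sum>k\<le>?d. ?C k * (g \<sigma> * w \<sigma> ^ (n + k)))"
    unfolding sum_distrib_left by (rule sum.swap)
  also have "\<dots> = (\<Sum>\<sigma>\<in>?P. g \<sigma> * w \<sigma> ^ n * poly (widom_poly m c x) (w \<sigma>))"
    by (simp add: poly_altdef degree_widom_poly sum_distrib_left power_add mult_ac)
  also have "\<dots> = 0" by (intro sum.neutral) (simp add: root)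
  finally show ?thesis
    using vandermonde_det_nonzero[of z "m + m"] inj by (simp add: z_def)
qed

section \<open>Coinciding roots by continuity\<close>

lemma tendsto_coeff_prod:
  fixes f :: "'a \<Rightarrow> 'b \<Rightarrow> complex poly"
  assumes "\<And>k i. k \<in> A \<Longrightarrow> ((\<lambda>t. coeff (f t k) i) \<longlongrightarrow> coeff (g k) i) F"
  shows "((\<lambda>t. coeff (\<Prod>k\<in>A. f t k) i) \<longlongrightarrow> coeff (\<Prod>k\<in>A. g k) i) F"
  using assms
proof (induction A arbitrary: i rule: infinite_finite_induct)
  case (insert k A)
  then show ?case by (auto simp: coeff_mult intro!: tendsto_intros)
qed auto

lemma tendsto_coeff_linear:
  fixes f :: "'a \<Rightarrow> complex"
  assumes "(f \<longlongrightarrow> l) F"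
  shows "((\<lambda>t. coeff [:- f t, 1:] i) \<longlongrightarrow> coeff [:- l, 1:] i) F"
  using assms by (cases i) (auto intro!: tendsto_intros)

lemma tendsto_det:
  fixes M :: "'a \<Rightarrow> complex mat"
  assumes "\<And>t. M t \<in> carrier_mat n n" "N \<in> carrier_mat n n"
    and "\<And>i j. i < n \<Longrightarrow> j < n \<Longrightarrow> ((\<lambda>t. M t $$ (i, j)) \<longlongrightarrow> N $$ (i, j)) F"
  shows "((\<lambda>t. det (M t)) \<longlongrightarrow> det N) F"
  unfolding det_def'[OF assms(1)] det_def'[OF assms(2)]
  by (intro tendsto_intros assms(3)) (auto simp: permutes_less)

text \<open>\<open>B - {a}\<close> is closed and misses \<open>a\<close>; whether \<open>a\<close>
  itself lies in \<open>B\<close> is invisible to the punctured filter \<open>at a\<close>.\<close>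

lemma eventually_at_not_in_finite:
  fixes a :: "'a :: t1_space"
  assumes "finite B"
  shows "eventually (\<lambda>t. t \<notin> B) (at a)"
proof -
  have "open (- (B - {a}))" using assms by (intro open_Compl finite_imp_closed) auto
  then show ?thesis
    unfolding eventually_at_topological by (intro exI[of _ "- (B - {a})"]) auto
qed

text \<open>Coinciding roots are separated by moving \<open>x i\<close> to \<open>x i + (i + 1) t\<close>: this fails for only
  finitely many \<open>t\<close>, and both sides of the recurrence are continuous in \<open>t\<close>.\<close>

lemma widom_poly_annihilates:
  assumes nz: "\<And>i. x i \<noteq> 0"
  shows "(\<Sum>k\<le>card (sign_vectors m). coeff (widom_poly m c x) k *
    det (band_toeplitz m (smult c (paired_poly m x)) (n + k))) = 0"
proof -
  define F where "F x = (\<Sum>k\<le>card (sign_vectors m). coeff (widom_poly m c x) k *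
    det (band_toeplitz m (smult c (paired_poly m x)) (n + k)))" for x
  define l :: "nat \<Rightarrow> complex poly" where "l i = [:x i, of_nat (Suc i):]" for i
  define y where "y t i = poly (l i) t" for t i
  define Z where "Z p = {t. poly p t = 0}" for p :: "complex poly"
  \<comment> \<open>The unions exclude \<open>y t i * y t j = 1\<close> (also for
    \<open>i = j\<close>), \<open>y t i = 0\<close>, and \<open>y t i = y t j\<close> for
    \<open>i \<noteq> j\<close>. Each polynomial is nonzero: the first has \<open>t ^ 2\<close>
    coefficient \<open>(i + 1) * (j + 1)\<close>, the second has constant term \<open>x i\<close>,
    the third has nonzero slope.\<close>
  define bad where "bad = (\<Union>i<m. \<Union>j<m. Z (l i * l j - 1)) \<union> (\<Union>i<m. Z (l i)) \<union>
    (\<Union>i<m. \<Union>j\<in>{..<m}-{i}. Z (l i - l j))"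
  have "finite (Z (l i * l j - 1))" for i j
  proof -
    have "coeff (l i * l j - 1) 2 \<noteq> 0"
      by (simp add: l_def numeral_2_eq_2 coeff_pCons del: of_nat_Suc)
    then show ?thesis unfolding Z_def by (intro poly_roots_finite) auto
  qed
  moreover have "finite (Z (l i))" for i
    unfolding Z_def by (intro poly_roots_finite) (simp add: l_def nz)
  moreover have "finite (Z (l i - l j))" if "j \<noteq> i" for i j
    unfolding Z_def using that by (intro poly_roots_finite) (simp add: l_def)
  ultimately have "finite bad" by (auto simp: bad_def)
  then have "eventually (\<lambda>t. t \<notin> bad) (at 0)" by (rule eventually_at_not_in_finite)
  then have "eventually (\<lambda>t. F (y t) = 0) (at 0)"
  proof eventually_elim
    case (elim t)
    have y0: "y t i \<noteq> 0" if "i < m" for i using elim that by (auto simp: bad_def Z_def y_def)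
    have y1: "y t i * y t j \<noteq> 1" if "i < m" "j < m" for i j
      using elim that by (auto simp: bad_def Z_def y_def)
    have yd: "y t i \<noteq> y t j" if "i < m" "j < m" "i \<noteq> j" for i j
      using elim that by (auto simp: bad_def Z_def y_def)
    have yi: "y t i \<noteq> inverse (y t j)" if "i < m" "j < m" for i j
      using y1[OF that] y0[OF that(2)] by (metis left_inverse)
    have "inj_on (paired_roots m (y t)) {..<m+m}"
    proof (rule inj_onI)
      have lt: "j - m < m" if "j < m + m" "\<not> j < m" for j using that by linarith
      fix k k' assume "k \<in> {..<m+m}" "k' \<in> {..<m+m}" "paired_roots m (y t) k = paired_roots m (y t) k'"
      then show "k = k'"
        using lt[of k] lt[of k'] yd[of k k'] yd[of "k - m" "k' - m"] yi[of k "k' - m"] yi[of k' "k - m"]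
        by (cases "k < m"; cases "k' < m") (auto simp: paired_roots_def eq_diff_iff dest: sym)
    qed
    then show ?case unfolding F_def using y0 by (intro widom_poly_annihilates_distinct) auto
  qed
  moreover have "((\<lambda>t. F (y t)) \<longlongrightarrow> F x) (at 0)"
  proof -
    have y: "((\<lambda>t. y t i) \<longlongrightarrow> x i) (at 0)" for i
      unfolding y_def l_def by (auto intro!: tendsto_eq_intros)
    have "((\<lambda>t. coeff (widom_poly m c (y t)) i) \<longlongrightarrow> coeff (widom_poly m c x) i) (at 0)" for i
      unfolding widom_poly_def
      by (intro tendsto_coeff_prod tendsto_coeff_linear tendsto_intros y nz)
    moreover have "((\<lambda>t. paired_roots m (y t) k) \<longlongrightarrow> paired_roots m x k) (at 0)" for k
      by (cases "k < m") (auto simp: paired_roots_def nz intro!: tendsto_intros y)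
    then have p: "((\<lambda>t. coeff (paired_poly m (y t)) i) \<longlongrightarrow> coeff (paired_poly m x) i) (at 0)" for i
      unfolding paired_poly_def by (intro tendsto_coeff_prod tendsto_coeff_linear)
    have "((\<lambda>t. det (band_toeplitz m (smult c (paired_poly m (y t))) n)) \<longlongrightarrow>
      det (band_toeplitz m (smult c (paired_poly m x)) n)) (at 0)" for n
      by (rule tendsto_det[of _ n]) (auto simp: band_toeplitz_def intro!: tendsto_intros p)
    ultimately show ?thesis unfolding F_def by (intro tendsto_intros)
  qed
  ultimately have "F x = 0"
    using tendsto_unique[OF _ _ tendsto_eventually, of "at 0" "\<lambda>t. F (y t)" "F x" 0] by auto
  then show ?thesis by (simp add: F_def)
qed

section \<open>Reduction to a nonzero outer coefficient and the degree bound\<close>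

theorem theorem3p3:
  fixes m :: nat and a :: "nat \<Rightarrow> complex"
  assumes "m \<ge> 1"
  shows "\<exists>d c. real d \<le> (3 ^ m + 1) / 2 \<and>
           annihilating_recurrence (toeplitz_det (sym_band_ext m a)) d c"
proof (cases "\<exists>j\<le>m. a j \<noteq> 0")
  case False
  then have "toeplitz_mat (sym_band_ext m a) n = 0\<^sub>m n n" for n
    by (intro eq_matI) (auto simp: toeplitz_mat_def sym_band_ext_def)
  \<comment> \<open>Here \<open>D_0 = 1\<close> and all later determinants are 0, so degree 0 fails
    but degree 1 with coefficient 0 works.\<close>
  then have "annihilating_recurrence (toeplitz_det (sym_band_ext m a)) 1 (\<lambda>_. 0)"
    by (simp add: annihilating_recurrence_def toeplitz_det_def)
  moreover have "real 1 \<le> (3 ^ m + 1) / 2" using one_le_power[of "3::real" m] by simp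
  ultimately show ?thesis by blast
next
  case True
  \<comment> \<open>The effective bandwidth \<open>r\<close> may be 0; it gives the same Toeplitz
    matrices and has \<open>a r \<noteq> 0\<close>, as the factorization requires.\<close>
  define r where "r = Max {j. j \<le> m \<and> a j \<noteq> 0}"
  have fin: "finite {j. j \<le> m \<and> a j \<noteq> 0}" by simp
  have "r \<in> {j. j \<le> m \<and> a j \<noteq> 0}"
    unfolding r_def using True by (intro Max_in fin) auto
  then have r: "r \<le> m" "a r \<noteq> 0" by auto
  have "a j = 0" if "j \<le> m" "r < j" for j
    using that Max_ge[OF fin, of j] unfolding r_def by fastforce
  then have ext: "sym_band_ext m a = sym_band_ext r a"
    using r(1) by (auto simp: sym_band_ext_def fun_eq_iff)
  obtain x where x: "\<And>i. x i \<noteq> 0" "sym_poly r a = smult (a r) (paired_poly r x)"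
    using sym_poly_factorization[of a r] r(2) by auto
  define u where "u = toeplitz_det (sym_band_ext m a)"
  define d where "d = card (sign_vectors r)"
  define p where "p = widom_poly r (a r) x"
  \<comment> \<open>Reversing the index matches the coefficients of \<open>p\<close> to the
    recurrence; at \<open>k = 0\<close> the leading coefficient 1 supplies the separate
    term.\<close>
  have "annihilating_recurrence u d (\<lambda>k. coeff p (d - k))"
    unfolding annihilating_recurrence_def
  proof
    fix n
    have "u (n + d) + (\<Sum>k=1..d. coeff p (d - k) * u (n + d - k)) =
      (\<Sum>k=0..d. coeff p (d - k) * u (n + d - k))"
      using coeff_widom_poly_lead[of r "a r" x] by (simp add: sum.atLeast_Suc_atMost p_def d_def)
    also have "\<dots> = (\<Sum>k\<le>d. coeff p k * u (n + k))"
      by (rule sum.reindex_bij_witness[of _ "\<lambda>k. d - k" "\<lambda>k. d - k"]) auto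
    also have "\<dots> = 0"
      using widom_poly_annihilates[where x = x and m = r and c = "a r" and n = n] x(1)
      by (simp add: u_def d_def p_def toeplitz_det_def ext toeplitz_mat_sym_band_ext x(2))
    finally show "u (n + d) + (\<Sum>k=1..d. coeff p (d - k) * u (n + d - k)) = 0" .
  qed
  moreover have "real d \<le> (3 ^ m + 1) / 2"
  proof -
    have "2 * real d = real (3 ^ r + 1)"
      unfolding d_def card_sign_vectors(2)[of r, symmetric] by simp
    also have "\<dots> \<le> 3 ^ m + 1" using r(1) by simp
    finally show ?thesis by simp
  qed
  ultimately show ?thesis unfolding u_def by blast
qed

end
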